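(* Let $j\geq 2$ be an integer and let $f:[0,1]\to\mathbb{R}$. The following statements are equivalent: (a) $f\in C^2[0,1]\cap K_j^{[1]}$; (b) $f\in C^2[0,1]$, and $f'(x)\geq 0$ and $xf''(x)-(j-1)f'(x)\geq 0$ for all $x\in[0,1]$; (c) there exists $\varphi\in\Omega$ such that $f(x)=f(0)+\int_0^x t^{j-1}\varphi(t)\,dt$ for all $x\in[0,1]$.
   Context: $K_j^{[1]}$ is the set of all $f\in C[0,1]$ such that $f$ is increasing (in the weak sense, i.e. nondecreasing) and the function $g(x):=f(x^{1/j})$ is convex on $[0,1]$. $\Omega$ (which depends on $j$) is the set of all real-valued functions $\omega$ such that: (i) $\omega\in C[0,1]\cap C^1(0,1]$; (ii) $\omega(x)\geq 0$ for $x\in[0,1]$; (iii) $\omega'(x)\geq 0$ for $x\in(0,1]$; (iv) the limit $\lim_{x\to 0}x^{j-1}\omega'(x)$ exists and is a (finite) real number. *)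

theory Defs
  imports "HOL-Analysis.Analysis"
begin

text \<open>
  Functions on an interval are rendered as total functions \<open>real \<Rightarrow> real\<close>, of which only the
  restriction to the interval matters. Accordingly all derivatives are taken within the
  interval, hence one-sided at the endpoints belonging to it. All intervals used below are
  nondegenerate, so these derivatives are unique.
\<close>

definition deriv_within :: "(real \<Rightarrow> real) \<Rightarrow> real set \<Rightarrow> real \<Rightarrow> real" where
  "deriv_within f S x = vector_derivative f (at x within S)"

primrec Ck :: "nat \<Rightarrow> real set \<Rightarrow> (real \<Rightarrow> real) set" where
  "Ck 0 S = {f. continuous_on S f}"
| "Ck (Suc k) S = {f. (\<forall>x\<in>S. f differentiable (at x within S)) \<and> deriv_within f S \<in> Ck k S}"

text \<open>The class \<open>K\<^sub>j\<^sup>[\<^sup>1\<^sup>]\<close>; on \<open>[0,1]\<close>, \<open>root j x\<close> is \<open>x\<close> to the power \<open>1/j\<close>, also for \<open>x = 0\<close>.\<close>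

definition K1 :: "nat \<Rightarrow> (real \<Rightarrow> real) set" where
  "K1 j = {f. continuous_on {0..1} f \<and> mono_on {0..1} f \<and> convex_on {0..1} (\<lambda>x. f (root j x))}"

definition Omega :: "nat \<Rightarrow> (real \<Rightarrow> real) set" where
  "Omega j = {\<omega>. \<omega> \<in> Ck 0 {0..1} \<inter> Ck 1 {0<..1}
      \<and> (\<forall>x\<in>{0..1}. \<omega> x \<ge> 0)
      \<and> (\<forall>x\<in>{0<..1}. deriv_within \<omega> {0<..1} x \<ge> 0)
      \<and> (\<exists>L. ((\<lambda>x. x ^ (j - 1) * deriv_within \<omega> {0<..1} x) \<longlongrightarrow> L) (at 0 within {0<..1}))}"

end

theory Submission imports Defs begin

text \<open>
  Everything is controlled by the ratio \<open>h t = f' t / t ^ (j - 1)\<close> on \<open>(0,1]\<close>. With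
  \<open>g x = f (root j x)\<close> and \<open>t = root j x\<close>, the chain rule gives \<open>g' x = h t / j\<close> on \<open>(0,1)\<close>, and
  \<open>h' t = (t * f'' t - (j - 1) * f' t) / t ^ j\<close>.

  For (a) and (b): a continuous function on a closed interval that is differentiable in the
  interior is convex if and only if its derivative is monotone there
  (\<open>convex_on_Icc_iff_mono_deriv\<close>). So \<open>g\<close> is convex if and only if \<open>h\<close> is nondecreasing on
  \<open>(0,1)\<close> (\<open>convex_on_root_iff\<close>), that is, if and only if \<open>t * f'' t - (j - 1) * f' t \<ge> 0\<close> there.
  For \<open>f\<close> of class \<open>C\<^sup>2\<close> both inequalities in (b) extend to the endpoints by continuity
  (\<open>K1_iff\<close>).

  For (b) and (c): the weight \<open>\<phi>\<close> has to be \<open>h\<close>. Given (b), \<open>h\<close> is nonnegative and nondecreasing,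
  hence has a finite limit at \<open>0\<close>, which is used as its value there; at \<open>x = 0\<close> the inequalities
  force \<open>f' 0 = 0\<close>, so that \<open>t ^ (j - 1) * h' t = f'' t - (j - 1) * f' t / t\<close> converges too
  (\<open>weight_exists\<close>). Conversely, \<open>f' x = x ^ (j - 1) * \<phi> x\<close>, whose derivative on \<open>(0,1]\<close> has a
  limit at \<open>0\<close> by the limit condition on \<open>\<phi>'\<close>. A function that is continuous on a closed interval
  and whose derivative in the interior extends continuously is differentiable at the endpoints
  as well (\<open>has_real_derivative_continuous_extension\<close>), so \<open>f\<close> is of class \<open>C\<^sup>2\<close>
  (\<open>derivs_of_weighted_integral\<close>).

  In the lemmas about \<open>f\<close>, \<open>p\<close> and \<open>q\<close> stand for its first and second derivative, and \<open>j\<close> is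
  written \<open>Suc (Suc n)\<close>, so that no truncated subtraction occurs in the exponents.
\<close>

section \<open>One-sided derivatives and the classes of smooth functions\<close>

lemma has_real_derivative_deriv_within:
  assumes "f differentiable (at x within S)"
  shows "(f has_real_derivative deriv_within f S x) (at x within S)"
  using assms by (simp add: deriv_within_def vector_derivative_works
      has_real_derivative_iff_has_vector_derivative)

lemma deriv_within_eqI:
  assumes "(f has_real_derivative D) (at x within S)" "connected S" "x \<in> S" "S \<noteq> {x}"
  shows "deriv_within f S x = D"
proof -
  have "x islimpt S"
    using assms(2-4) by (intro connected_imp_perfect) auto
  then show ?thesis
    using assms(1) unfolding deriv_within_def
    by (intro vector_derivative_within)
       (auto simp: trivial_limit_within has_real_derivative_iff_has_vector_derivative)
qed

lemma deriv_within_cong: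
  assumes "\<And>x. x \<in> S \<Longrightarrow> f x = g x" "x \<in> S"
  shows "deriv_within f S x = deriv_within g S x"
proof -
  have "(f has_vector_derivative D) (at x within S) \<longleftrightarrow>
        (g has_vector_derivative D) (at x within S)" for D
    using assms by (intro has_vector_derivative_cong_ev) (auto simp: eventually_at_filter)
  then show ?thesis
    by (simp add: deriv_within_def vector_derivative_def)
qed

lemma Ck_cong:
  assumes "\<And>x. x \<in> S \<Longrightarrow> f x = g x"
  shows "f \<in> Ck k S \<longleftrightarrow> g \<in> Ck k S"
  using assms
proof (induction k arbitrary: f g)
  case 0
  then show ?case by (simp cong: continuous_on_cong)
next
  case (Suc k)
  have "f differentiable (at x within S) \<longleftrightarrow> g differentiable (at x within S)" if "x \<in> S" for x
    using differentiable_transform_within[OF _ zero_less_one that, of f g]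
      differentiable_transform_within[OF _ zero_less_one that, of g f] Suc.prems by auto
  moreover have "deriv_within f S \<in> Ck k S \<longleftrightarrow> deriv_within g S \<in> Ck k S"
    by (intro Suc.IH deriv_within_cong Suc.prems)
  ultimately show ?case by auto
qed

text \<open>
  The values of \<open>deriv_within f S\<close> outside \<open>S\<close> are arbitrary, so a derivative of \<open>f\<close> that is known
  explicitly agrees with it only on \<open>S\<close>. The equivalence makes any such derivative usable.
\<close>

lemma Ck_Suc_iff:
  assumes "connected S" "\<And>x. S \<noteq> {x}"
  shows "f \<in> Ck (Suc k) S \<longleftrightarrow>
    (\<exists>g\<in>Ck k S. \<forall>x\<in>S. (f has_real_derivative g x) (at x within S))"
proof
  assume "f \<in> Ck (Suc k) S"
  then show "\<exists>g\<in>Ck k S. \<forall>x\<in>S. (f has_real_derivative g x) (at x within S)"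
    by (auto intro: has_real_derivative_deriv_within)
next
  assume "\<exists>g\<in>Ck k S. \<forall>x\<in>S. (f has_real_derivative g x) (at x within S)"
  then obtain g where g: "g \<in> Ck k S" "\<And>x. x \<in> S \<Longrightarrow> (f has_real_derivative g x) (at x within S)"
    by blast
  have "deriv_within f S x = g x" if "x \<in> S" for x
    by (rule deriv_within_eqI[OF g(2)[OF that] assms(1) that assms(2)])
  then have "deriv_within f S \<in> Ck k S"
    using g(1) Ck_cong[of S "deriv_within f S" g k] by simp
  moreover have "f differentiable (at x within S)" if "x \<in> S" for x
    using g(2)[OF that] by (auto simp: real_differentiable_def)
  ultimately show "f \<in> Ck (Suc k) S" by simp
qed

lemma Icc_not_singleton: "{0..1::real} \<noteq> {x}" "{0<..1::real} \<noteq> {x}"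
proof -
  have "S \<noteq> {x}" if "1/2 \<in> S" "1 \<in> S" for S :: "real set"
  proof
    assume "S = {x}"
    with that have "1/2 = x" "1 = x" by simp_all
    then show False by simp
  qed
  from this[of "{0..1}"] this[of "{0<..1}"]
  show "{0..1::real} \<noteq> {x}" "{0<..1::real} \<noteq> {x}" by simp_all
qed

section \<open>Monotonicity, convexity and the sign of derivatives\<close>

lemma continuous_on_nonneg_open_iff:
  fixes h :: "real \<Rightarrow> real"
  assumes "a < b" "continuous_on {a..b} h"
  shows "(\<forall>x\<in>{a..b}. h x \<ge> 0) \<longleftrightarrow> (\<forall>x\<in>{a<..<b}. h x \<ge> 0)"
proof -
  have "closure {a<..<b} = {a..b}" using assms(1) by simp
  then show ?thesis
    using continuous_ge_on_closure[of "{a<..<b}" h _ 0] assms(2) by auto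
qed

lemma mono_on_iff_deriv_nonneg:
  fixes h :: "real \<Rightarrow> real"
  assumes "continuous_on S h" "connected S"
    and d: "\<And>x. x \<in> interior S \<Longrightarrow> (h has_real_derivative h' x) (at x)"
  shows "mono_on S h \<longleftrightarrow> (\<forall>x\<in>interior S. h' x \<ge> 0)"
proof
  assume mono: "mono_on S h"
  show "\<forall>x\<in>interior S. h' x \<ge> 0"
    using mono_on_imp_deriv_nonneg[OF mono d] by simp
next
  assume nn: "\<forall>x\<in>interior S. h' x \<ge> 0"
  show "mono_on S h"
  proof (rule mono_onI)
    fix x y assume xy: "x \<in> S" "y \<in> S" "x \<le> y"
    have sub: "{x..y} \<subseteq> S"
      using connected_contains_Icc[OF assms(2) xy(1,2)] .
    then have int: "{x<..<y} \<subseteq> interior S"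
      by (intro interior_maximal) auto
    show "h x \<le> h y"
    proof (rule DERIV_nonneg_imp_increasing_open[OF xy(3) _ continuous_on_subset[OF assms(1) sub]])
      fix z assume "x < z" "z < y"
      then have "z \<in> interior S"
        using int by (auto simp only: subset_iff greaterThanLessThan_iff)
      then show "\<exists>D. DERIV h z :> D \<and> D \<ge> 0"
        using d nn by metis
    qed
  qed
qed

text \<open>
  Derivatives are taken in the interior only, since this serves for \<open>f (root j x)\<close>, where
  the chain rule breaks down at \<open>0\<close>. Convexity gives tangents
  below the graph, and adding the tangent inequalities at two points compares the slopes there.
  Conversely, the mean value theorem on both sides of an intermediate point turns chord slopes
  into values of the derivative.
\<close>

lemma convex_on_Icc_iff_mono_deriv:
  fixes g :: "real \<Rightarrow> real"
  assumes cont: "continuous_on {a..b} g"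
    and d: "\<And>x. x \<in> {a<..<b} \<Longrightarrow> (g has_real_derivative g' x) (at x)"
  shows "convex_on {a..b} g \<longleftrightarrow> mono_on {a<..<b} g'"
proof
  assume cvx: "convex_on {a..b} g"
  show "mono_on {a<..<b} g'"
  proof (rule mono_onI)
    fix x y assume xy: "x \<in> {a<..<b}" "y \<in> {a<..<b}" "x \<le> y"
    have tangent: "g v - g u \<ge> g' u * (v - u)" if "u \<in> {a<..<b}" "v \<in> {a<..<b}" for u v
      using that convex_on_imp_above_tangent[OF cvx, of u v "g' u"] d[of u]
      by (auto simp: has_field_derivative_at_within)
    have "(g' y - g' x) * (y - x) \<ge> 0"
      using tangent[of x y] tangent[of y x] xy by (simp add: algebra_simps)
    then show "g' x \<le> g' y"
      using xy(3) by (cases "x = y") (auto simp: zero_le_mult_iff)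
  qed
next
  assume mono: "mono_on {a<..<b} g'"
  show "convex_on {a..b} g"
  proof (rule convex_on_linorderI)
    fix t x y :: real
    assume t: "t > 0" "t < 1" and xy: "x \<in> {a..b}" "y \<in> {a..b}" "x < y"
    define z where "z = (1 - t) * x + t * y"
    have zx: "z - x = t * (y - x)" and yz: "y - z = (1 - t) * (y - x)"
      by (auto simp: z_def algebra_simps)
    have "z - x > 0" "y - z > 0"
      using t xy by (auto simp: zx yz)
    then have z: "x < z" "z < y" by auto
    have mvt: "\<exists>c\<in>{u<..<v}. g v - g u = (v - u) * g' c" 
      if uv: "a \<le> u" "u < v" "v \<le> b" for u v
    proof -
      obtain l c where c: "u < c" "c < v" "DERIV g c :> l" "g v - g u = (v - u) * l"
      proof (rule exE[OF MVT[OF \<open>u < v\<close>]])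
        show "continuous_on {u..v} g"
          using continuous_on_subset[OF cont] uv by simp
        show "g differentiable at x" if "u < x" "x < v" for x
          using d[of x] that uv by (auto simp: real_differentiable_def)
      qed blast
      then have "l = g' c"
        using d[of c] uv DERIV_unique by auto
      with c show ?thesis by auto
    qed
    obtain c e where c: "c \<in> {x<..<z}" "g z - g x = (z - x) * g' c"
      and e: "e \<in> {z<..<y}" "g y - g z = (y - z) * g' e"
      using mvt[of x z] mvt[of z y] z xy by auto
    have "g' c \<le> g' e"
      using mono c(1) e(1) xy by (auto simp: mono_on_def)
    then have "t * (1 - t) * (y - x) * g' c \<le> t * (1 - t) * (y - x) * g' e"
      using t xy by (intro mult_left_mono) auto
    then have "(1 - t) * (g z - g x) \<le> t * (g y - g z)"
      by (simp add: c(2) e(2) zx yz mult_ac)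
    then show "g ((1 - t) *\<^sub>R x + t *\<^sub>R y) \<le> (1 - t) * g x + t * g y"
      by (simp add: z_def algebra_simps)
  qed simp
qed

text \<open>
  By the fundamental theorem of calculus, which tolerates missing derivatives at the endpoints,
  \<open>f\<close> is a constant plus the integral of \<open>g\<close>; that integral is differentiable at the endpoints
  because \<open>g\<close> is continuous there.
\<close>

lemma has_real_derivative_continuous_extension:
  fixes f :: "real \<Rightarrow> real"
  assumes cf: "continuous_on {a..b} f" and cg: "continuous_on {a..b} g"
    and d: "\<And>x. x \<in> {a<..<b} \<Longrightarrow> (f has_real_derivative g x) (at x)"
    and x: "x \<in> {a..b}"
  shows "(f has_real_derivative g x) (at x within {a..b})"
proof -
  have eq: "f y = f a + integral {a..y} g" if "y \<in> {a..b}" for y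
  proof -
    have "(g has_integral (f y - f a)) {a..y}"
      using that d continuous_on_subset[OF cf, of "{a..y}"]
      by (intro fundamental_theorem_of_calculus_interior)
         (auto simp: has_real_derivative_iff_has_vector_derivative)
    then show ?thesis by (simp add: integral_unique)
  qed
  have "((\<lambda>y. f a + integral {a..y} g) has_real_derivative g x) (at x within {a..b})"
    using integral_has_real_derivative[OF cg x] by (auto intro!: derivative_eq_intros)
  then show ?thesis
    by (rule has_field_derivative_transform_within[OF _ zero_less_one x eq[symmetric]])
qed

section \<open>Convexity after the substitution of a root\<close>

lemma has_real_derivative_ratio_power:
  fixes p :: "real \<Rightarrow> real"
  assumes "(p has_real_derivative q) (at x within S)" "x \<noteq> 0"
  shows "((\<lambda>t. p t / t ^ Suc n) has_real_derivative (x * q - real (Suc n) * p x) / x ^ Suc (Suc n))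
           (at x within S)"
  by (rule derivative_eq_intros assms refl)+ (use assms(2) in \<open>auto simp: field_simps\<close>)

text \<open>
  The derivative of \<open>f (root j x)\<close> is \<open>1 / j\<close> times the ratio evaluated at \<open>root j x\<close>, and
  \<open>root j\<close> is an increasing bijection of \<open>(0,1)\<close>, which preserves monotonicity in both directions.
\<close>

lemma convex_on_root_iff:
  fixes f :: "real \<Rightarrow> real"
  assumes d: "\<And>x. x \<in> {0..1} \<Longrightarrow> (f has_real_derivative p x) (at x within {0..1})"
  shows "convex_on {0..1} (\<lambda>x. f (root (Suc (Suc n)) x)) \<longleftrightarrow> mono_on {0<..<1} (\<lambda>t. p t / t ^ Suc n)"
proof -
  let ?r = "root (Suc (Suc n))" and ?h = "\<lambda>t. p t / t ^ Suc n"
  have r: "?r x \<in> {0<..<1}" if "x \<in> {0<..<1}" for x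
    using that by auto
  have "continuous_on {0..1} f"
    using d by (meson DERIV_continuous continuous_on_eq_continuous_within)
  then have cont: "continuous_on {0..1} (\<lambda>x. f (?r x))"
    by (rule continuous_on_compose2) (auto intro!: continuous_intros)
  have deriv: "((\<lambda>x. f (?r x)) has_real_derivative ?h (?r x) / real (Suc (Suc n))) (at x)"
    if x: "x \<in> {0<..<1}" for x
  proof -
    have 1: "(f has_real_derivative p (?r x)) (at (?r x))"
      using d[of "?r x"] r[OF x] by (simp add: at_within_Icc_at)
    have 2: "(?r has_real_derivative inverse (real (Suc (Suc n)) * ?r x ^ Suc n)) (at x)"
      using x DERIV_real_root[of "Suc (Suc n)" x] by simp
    have "?h (?r x) / real (Suc (Suc n)) =
        p (?r x) * inverse (real (Suc (Suc n)) * ?r x ^ Suc n)"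
      by (simp only: divide_inverse inverse_mult_distrib mult_ac)
    then show ?thesis
      using DERIV_chain2[OF 1 2] by (simp only:)
  qed
  have cancel: "u / real (Suc (Suc n)) \<le> v / real (Suc (Suc n)) \<longleftrightarrow> u \<le> v" for u v
    by (simp add: divide_le_cancel)
  have "convex_on {0..1} (\<lambda>x. f (?r x)) \<longleftrightarrow> mono_on {0<..<1} (\<lambda>x. ?h (?r x) / real (Suc (Suc n)))"
    by (rule convex_on_Icc_iff_mono_deriv[OF cont deriv])
  also have "\<dots> \<longleftrightarrow> mono_on {0<..<1} (\<lambda>x. ?h (?r x))"
    unfolding mono_on_def cancel ..
  also have "\<dots> \<longleftrightarrow> mono_on {0<..<1} ?h"
  proof
    assume L: "mono_on {0<..<1} (\<lambda>x. ?h (?r x))"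
    \<comment> \<open>Evaluate at \<open>s ^ j\<close> and \<open>t ^ j\<close>, the preimages of \<open>s\<close> and \<open>t\<close> under the root.\<close>
    show "mono_on {0<..<1} ?h"
    proof (rule mono_onI)
      fix s t :: real assume st: "s \<in> {0<..<1}" "t \<in> {0<..<1}" "s \<le> t"
      have "s ^ Suc (Suc n) \<in> {0<..<1}" "t ^ Suc (Suc n) \<in> {0<..<1}"
        using st power_Suc_less_one[of s] power_Suc_less_one[of t]
        by (auto simp del: power_Suc)
      moreover have "s ^ Suc (Suc n) \<le> t ^ Suc (Suc n)"
        using st by (intro power_mono) auto
      moreover have "?r (s ^ Suc (Suc n)) = s" "?r (t ^ Suc (Suc n)) = t"
        using st by (auto intro!: real_root_power_cancel simp del: power_Suc)
      ultimately show "?h s \<le> ?h t"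
        using mono_onD[OF L, of "s ^ Suc (Suc n)" "t ^ Suc (Suc n)"] by metis
    qed
  next
    assume "mono_on {0<..<1} ?h"
    then show "mono_on {0<..<1} (\<lambda>x. ?h (?r x))"
      using r unfolding mono_on_def by (simp add: real_root_le_mono)
  qed
  finally show ?thesis .
qed

text \<open>
  Both conditions that define \<open>K1\<close> amount to an inequality on the open interval, where the
  derivatives are two-sided and one may divide by powers of \<open>x\<close>. The inequalities then pass to
  the endpoints because \<open>p\<close> and \<open>q\<close> are continuous.
\<close>

lemma K1_iff:
  fixes f :: "real \<Rightarrow> real"
  assumes f: "\<And>x. x \<in> {0..1} \<Longrightarrow> (f has_real_derivative p x) (at x within {0..1})"
    and p: "\<And>x. x \<in> {0..1} \<Longrightarrow> (p has_real_derivative q x) (at x within {0..1})"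
    and q: "continuous_on {0..1} q"
  shows "f \<in> K1 (Suc (Suc n)) \<longleftrightarrow>
    (\<forall>x\<in>{0..1}. p x \<ge> 0 \<and> x * q x - real (Suc n) * p x \<ge> 0)"
proof -
  have cf: "continuous_on {0..1} f" and cp: "continuous_on {0..1} p"
    using f p by (meson DERIV_continuous continuous_on_eq_continuous_within)+
  have f': "(f has_real_derivative p x) (at x)" and p': "(p has_real_derivative q x) (at x)"
    if "x \<in> {0<..<1}" for x
    using that f[of x] p[of x] by (auto simp: at_within_Icc_at)
  have "mono_on {0..1} f \<longleftrightarrow> (\<forall>x\<in>{0<..<1}. p x \<ge> 0)"
    using mono_on_iff_deriv_nonneg[OF cf, of p] f' by simp
  also have "\<dots> \<longleftrightarrow> (\<forall>x\<in>{0..1}. p x \<ge> 0)"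
    using cp by (subst continuous_on_nonneg_open_iff) auto
  finally have mono: "mono_on {0..1} f \<longleftrightarrow> (\<forall>x\<in>{0..1}. p x \<ge> 0)" .
  have d: "((\<lambda>t. p t / t ^ Suc n) has_real_derivative
             (x * q x - real (Suc n) * p x) / x ^ Suc (Suc n)) (at x)" if "x \<in> {0<..<1}" for x
    using that p'[of x] by (intro has_real_derivative_ratio_power) auto
  have "continuous_on {0<..<1} (\<lambda>t. p t / t ^ Suc n)"
    using d by (meson DERIV_isCont continuous_at_imp_continuous_on)
  then have "mono_on {0<..<1} (\<lambda>t. p t / t ^ Suc n) \<longleftrightarrow>
      (\<forall>x\<in>{0<..<1}. (x * q x - real (Suc n) * p x) / x ^ Suc (Suc n) \<ge> 0)"
    using mono_on_iff_deriv_nonneg[of "{0<..<1}" "\<lambda>t. p t / t ^ Suc n"] d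
    by (simp del: power_Suc of_nat_Suc)
  also have "\<dots> \<longleftrightarrow> (\<forall>x\<in>{0<..<1}. x * q x - real (Suc n) * p x \<ge> 0)"
  proof (intro ball_cong refl)
    fix x :: real assume "x \<in> {0<..<1}"
    then have "0 < x ^ Suc (Suc n)" by (intro zero_less_power) simp
    then show "(x * q x - real (Suc n) * p x) / x ^ Suc (Suc n) \<ge> 0 \<longleftrightarrow>
        x * q x - real (Suc n) * p x \<ge> 0"
      by (simp only: pos_le_divide_eq mult_zero_left)
  qed
  also have "\<dots> \<longleftrightarrow> (\<forall>x\<in>{0..1}. x * q x - real (Suc n) * p x \<ge> 0)"
    using cp q by (subst continuous_on_nonneg_open_iff) (auto intro!: continuous_intros)
  finally show ?thesis
    using cf mono convex_on_root_iff[OF f, of n] by (auto simp: K1_def)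
qed

section \<open>The class of admissible weights\<close>

lemma at_within_Ioc: "x > 0 \<Longrightarrow> at x within {0<..1::real} = at x within {0..1}"
  by (rule at_within_nhd[of _ "{0<..}"]) auto

lemma at_0_within_Icc: "at 0 within {0..1} = at 0 within {0<..1::real}"
  by (simp add: at_within_def, rule arg_cong[where f = "\<lambda>S. inf _ (principal S)"]) auto

text \<open>
  An arbitrary witness \<open>\<psi>\<close> for the derivative, with all derivatives and limits taken within
  the closed interval, spares later arguments the passage between \<open>(0,1]\<close> and \<open>[0,1]\<close>.
\<close>

lemma Omega_iff:
  "\<omega> \<in> Omega j \<longleftrightarrow> continuous_on {0..1} \<omega> \<and> (\<forall>x\<in>{0..1}. \<omega> x \<ge> 0) \<and>
    (\<exists>\<psi>. continuous_on {0<..1} \<psi> \<and> (\<forall>x\<in>{0<..1}. \<psi> x \<ge> 0) \<and>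
       (\<forall>x\<in>{0<..1}. (\<omega> has_real_derivative \<psi> x) (at x within {0..1})) \<and>
       (\<exists>L. ((\<lambda>x. x ^ (j - 1) * \<psi> x) \<longlongrightarrow> L) (at 0 within {0..1})))"
    (is "_ \<longleftrightarrow> ?R")
proof
  assume w: "\<omega> \<in> Omega j"
  show ?R
  proof (intro conjI exI[of _ "deriv_within \<omega> {0<..1}"])
    show "\<forall>x\<in>{0<..1}. (\<omega> has_real_derivative deriv_within \<omega> {0<..1} x) (at x within {0..1})"
      using w by (auto simp: Omega_def intro!: has_real_derivative_deriv_within
          simp flip: at_within_Ioc)
  qed (use w in \<open>auto simp: Omega_def at_0_within_Icc\<close>)
next
  assume ?R
  then obtain \<psi> L where w: "continuous_on {0..1} \<omega>" "\<forall>x\<in>{0..1}. \<omega> x \<ge> 0"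
    and \<psi>: "continuous_on {0<..1} \<psi>" "\<forall>x\<in>{0<..1}. \<psi> x \<ge> 0"
    and d: "\<forall>x\<in>{0<..1}. (\<omega> has_real_derivative \<psi> x) (at x within {0<..1})"
    and L: "((\<lambda>x. x ^ (j - 1) * \<psi> x) \<longlongrightarrow> L) (at 0 within {0<..1})"
    by (auto simp: at_within_Ioc at_0_within_Icc)
  have eq: "deriv_within \<omega> {0<..1} x = \<psi> x" if "x \<in> {0<..1}" for x
    using that d Icc_not_singleton by (intro deriv_within_eqI) auto
  have "\<omega> \<in> Ck (Suc 0) {0<..1}"
    using \<psi>(1) d Icc_not_singleton by (subst Ck_Suc_iff) auto
  moreover have "((\<lambda>x. x ^ (j - 1) * deriv_within \<omega> {0<..1} x) \<longlongrightarrow> L) (at 0 within {0<..1})"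
    using L by (rule Lim_transform_within[where d = 1]) (auto simp: eq)
  ultimately show "\<omega> \<in> Omega j"
    using w \<psi>(2) eq by (auto simp: Omega_def simp del: Ck.simps(2))
qed

section \<open>From the differential inequalities to a weight\<close>

text \<open>The limit is the infimum of the values.\<close>

lemma mono_on_bounded_below_tendsto_left_end:
  fixes h :: "real \<Rightarrow> real"
  assumes mono: "mono_on {a<..b} h" and "a < b" and nn: "\<And>x. x \<in> {a<..b} \<Longrightarrow> h x \<ge> m"
  shows "\<exists>l\<ge>m. (h \<longlongrightarrow> l) (at a within {a..b})"
proof (intro exI conjI)
  let ?l = "Inf (h ` {a<..b})"
  have bdd: "bdd_below (h ` {a<..b})"
    using nn by (rule bdd_belowI2)
  have ne: "h ` {a<..b} \<noteq> {}"
    using \<open>a < b\<close> by simp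
  show "m \<le> ?l"
  proof (rule cInf_greatest[OF ne])
    fix y assume "y \<in> h ` {a<..b}"
    then show "m \<le> y" using nn by (elim imageE) (simp only:)
  qed
  show "(h \<longlongrightarrow> ?l) (at a within {a..b})"
  proof (rule decreasing_tendsto)
    show "eventually (\<lambda>x. ?l \<le> h x) (at a within {a..b})"
      unfolding eventually_at_filter
    proof (intro always_eventually allI impI)
      fix x assume "x \<noteq> a" "x \<in> {a..b}"
      then have "x \<in> {a<..b}" by simp
      then show "?l \<le> h x"
        by (intro cInf_lower[OF _ bdd] imageI)
    qed
  next
    fix u assume "?l < u"
    then obtain c where c: "c \<in> {a<..b}" "h c < u"
      using ne by (metis cInf_lessD imageE)
    then have "eventually (\<lambda>x. x \<in> {..<c}) (nhds a)"
      by (intro eventually_nhds_in_open) auto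
    then show "eventually (\<lambda>x. h x < u) (at a within {a..b})"
      unfolding eventually_at_filter
    proof eventually_elim
      case (elim x)
      then show ?case
        using c mono_onD[OF mono, of x c] by (fastforce intro: le_less_trans)
    qed
  qed
qed

text \<open>
  The weight is the ratio \<open>p t / t ^ (j - 1)\<close>, continued to \<open>0\<close> by its limit. The limit
  exists because the ratio is nondecreasing and nonnegative; for \<open>j > 2\<close> the first two
  derivatives of \<open>f\<close> at \<open>0\<close> do not determine it.
\<close>

lemma weight_exists:
  fixes f :: "real \<Rightarrow> real"
  assumes f: "\<And>x. x \<in> {0..1} \<Longrightarrow> (f has_real_derivative p x) (at x within {0..1})"
    and p: "\<And>x. x \<in> {0..1} \<Longrightarrow> (p has_real_derivative q x) (at x within {0..1})"
    and q: "continuous_on {0..1} q"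
    and nn: "\<And>x. x \<in> {0..1} \<Longrightarrow> p x \<ge> 0"
      "\<And>x. x \<in> {0..1} \<Longrightarrow> x * q x - real (Suc n) * p x \<ge> 0"
  shows "\<exists>\<phi>\<in>Omega (Suc (Suc n)). \<forall>x\<in>{0..1}. f x = f 0 + integral {0..x} (\<lambda>t. t ^ Suc n * \<phi> t)"
proof -
  define h where "h = (\<lambda>t. p t / t ^ Suc n)"
  define \<psi> where "\<psi> = (\<lambda>x. (x * q x - real (Suc n) * p x) / x ^ Suc (Suc n))"
  have cp: "continuous_on {0..1} p"
    using p by (meson DERIV_continuous continuous_on_eq_continuous_within)
  \<comment> \<open>At \<open>x = 0\<close> the second inequality says that \<open>p 0\<close> is not positive.\<close>
  have p0: "p 0 = 0"
    using nn(1)[of 0] nn(2)[of 0] by (simp add: mult_le_0_iff)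
  have dh: "(h has_real_derivative \<psi> x) (at x within {0..1})" if "x \<in> {0<..1}" for x
    unfolding h_def \<psi>_def using that p[of x] by (intro has_real_derivative_ratio_power) auto
  have \<psi>nn: "\<psi> x \<ge> 0" if "x \<in> {0<..1}" for x
    using that nn(2)[of x] by (simp add: \<psi>_def)
  have Ioc: "{0<..1} \<subseteq> {0..1::real}" by auto
  have ch: "continuous_on {0<..1} h"
    unfolding h_def by (intro continuous_intros continuous_on_subset[OF cp Ioc]) auto
  have "mono_on {0<..1} h"
  proof -
    have "(h has_real_derivative \<psi> x) (at x)" if "x \<in> interior {0<..1}" for x
      using that dh[of x] by (simp add: at_within_Icc_at)
    moreover have "\<psi> x \<ge> 0" if "x \<in> interior {0<..1}" for x
      using that interior_subset \<psi>nn by blast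
    ultimately show ?thesis
      using mono_on_iff_deriv_nonneg[OF ch connected_Ioc] by metis
  qed
  moreover have "h x \<ge> 0" if "x \<in> {0<..1}" for x
    using that nn(1)[of x] by (simp add: h_def)
  ultimately obtain l where l: "l \<ge> 0" "(h \<longlongrightarrow> l) (at 0 within {0..1})"
    using mono_on_bounded_below_tendsto_left_end[of 0 1 h 0] zero_less_one by metis
  define \<phi> where "\<phi> = h(0 := l)"
  have d\<phi>: "(\<phi> has_real_derivative \<psi> x) (at x within {0..1})" if x: "x \<in> {0<..1}" for x
  proof (rule has_field_derivative_transform_within[OF dh[OF x]])
    show "h y = \<phi> y" if "dist y x < x" for y
      using that by (auto simp: \<phi>_def dist_real_def)
  qed (use x in auto)
  have c\<phi>: "continuous_on {0..1} \<phi>"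
  proof (unfold continuous_on_eq_continuous_within, rule ballI)
    fix x :: real assume x: "x \<in> {0..1}"
    show "continuous (at x within {0..1}) \<phi>"
    proof (cases "x = 0")
      case True
      have "(\<phi> \<longlongrightarrow> l) (at 0 within {0..1})"
        using l(2) by (rule Lim_transform_within[where d = 1]) (auto simp: \<phi>_def)
      then show ?thesis
        by (simp add: True continuous_within \<phi>_def)
    next
      case False
      then show ?thesis
        using d\<phi>[of x] x by (intro DERIV_continuous) auto
    qed
  qed
  \<comment> \<open>As \<open>p 0 = 0\<close>, the quotient \<open>p x / x\<close> tends to \<open>q 0\<close>.\<close>
  have lim: "((\<lambda>x. x ^ Suc n * \<psi> x) \<longlongrightarrow> q 0 - real (Suc n) * q 0) (at 0 within {0..1})"
  proof (rule Lim_transform_within[where d = 1])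
    have "((\<lambda>x. p x / x) \<longlongrightarrow> q 0) (at 0 within {0..1})"
      using p[of 0] by (simp add: has_field_derivative_iff p0)
    moreover have "(q \<longlongrightarrow> q 0) (at 0 within {0..1})"
      using q by (simp add: continuous_on_def)
    ultimately show "((\<lambda>x. q x - real (Suc n) * (p x / x)) \<longlongrightarrow> q 0 - real (Suc n) * q 0)
        (at 0 within {0..1})"
      by (intro tendsto_intros)
  qed (auto simp: \<psi>_def field_simps)
  have "continuous_on {0<..1} \<psi>"
    unfolding \<psi>_def
    by (intro continuous_intros continuous_on_subset[OF cp Ioc] continuous_on_subset[OF q Ioc]) auto
  then have "\<phi> \<in> Omega (Suc (Suc n))"
    unfolding Omega_iff using c\<phi> \<psi>nn d\<phi> lim nn(1) l(1)
    by (auto simp: \<phi>_def h_def simp del: power_Suc of_nat_Suc)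
  moreover have "f x = f 0 + integral {0..x} (\<lambda>t. t ^ Suc n * \<phi> t)" if x: "x \<in> {0..1}" for x
  proof -
    have eq: "t ^ Suc n * \<phi> t = p t" for t
      by (auto simp: \<phi>_def h_def p0)
    have "(p has_integral (f x - f 0)) {0..x}"
    proof (rule fundamental_theorem_of_calculus)
      show "(f has_vector_derivative p t) (at t within {0..x})" if "t \<in> {0..x}" for t
        using that x f[of t] DERIV_subset[of f "p t" t "{0..1}" "{0..x}"]
        by (auto simp: has_real_derivative_iff_has_vector_derivative)
    qed (use x in auto)
    then show ?thesis unfolding eq by (simp add: integral_unique)
  qed
  ultimately show ?thesis by blast
qed

section \<open>From a weight to the differential inequalities\<close>

text \<open>
  The second derivative \<open>q\<close> comes from the product rule on \<open>(0,1]\<close>, with \<open>x ^ (j - 1) * \<psi> x\<close>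
  continued to \<open>0\<close> by its limit \<open>L\<close>. This \<open>q\<close> is continuous on \<open>[0,1]\<close>, and by continuous extension
  it is the derivative of \<open>p\<close> at \<open>0\<close> too.
\<close>

lemma derivs_of_weighted_integral:
  fixes f :: "real \<Rightarrow> real"
  assumes "\<phi> \<in> Omega (Suc (Suc n))"
    and f: "\<And>x. x \<in> {0..1} \<Longrightarrow> f x = f 0 + integral {0..x} (\<lambda>t. t ^ Suc n * \<phi> t)"
  obtains p q where
      "\<And>x. x \<in> {0..1} \<Longrightarrow> (f has_real_derivative p x) (at x within {0..1})"
      "\<And>x. x \<in> {0..1} \<Longrightarrow> (p has_real_derivative q x) (at x within {0..1})"
      "continuous_on {0..1} q"
      "\<And>x. x \<in> {0..1} \<Longrightarrow> p x \<ge> 0 \<and> x * q x - real (Suc n) * p x \<ge> 0"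
proof -
  from assms(1) obtain \<psi> L where c: "continuous_on {0..1} \<phi>" and nn: "\<And>x. x \<in> {0..1} \<Longrightarrow> \<phi> x \<ge> 0"
    and \<psi>: "continuous_on {0<..1} \<psi>" "\<And>x. x \<in> {0<..1} \<Longrightarrow> \<psi> x \<ge> 0"
    and d: "\<And>x. x \<in> {0<..1} \<Longrightarrow> (\<phi> has_real_derivative \<psi> x) (at x within {0..1})"
    and L: "((\<lambda>x. x ^ Suc n * \<psi> x) \<longlongrightarrow> L) (at 0 within {0..1})"
    by (auto simp: Omega_iff simp del: power_Suc)
  define p where "p = (\<lambda>x. x ^ Suc n * \<phi> x)"
  define q where "q = (\<lambda>x. real (Suc n) * x ^ n * \<phi> x + (if x = 0 then L else x ^ Suc n * \<psi> x))"
  have cp: "continuous_on {0..1} p"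
    unfolding p_def using c by (intro continuous_intros)
  have "((\<lambda>x. f 0 + integral {0..x} p) has_real_derivative p x) (at x within {0..1})"
    if "x \<in> {0..1}" for x
    using integral_has_real_derivative[OF cp that] by (auto intro!: derivative_eq_intros)
  from has_field_derivative_transform_within[OF this zero_less_one _ f[folded p_def, symmetric]]
  have 1: "(f has_real_derivative p x) (at x within {0..1})" if "x \<in> {0..1}" for x
    using that by blast
  have "continuous_on {0..1} (\<lambda>x. if x = 0 then L else x ^ Suc n * \<psi> x)" (is "continuous_on _ ?e")
  proof (unfold continuous_on_def, rule ballI)
    fix x :: real assume x: "x \<in> {0..1}"
    show "(?e \<longlongrightarrow> ?e x) (at x within {0..1})"
    proof (cases "x = 0")
      case True
      have "(?e \<longlongrightarrow> L) (at 0 within {0..1})"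
        using L by (rule Lim_transform_within[where d = 1]) auto
      with True show ?thesis by simp
    next
      case False
      have "continuous_on {0<..1} (\<lambda>x. x ^ Suc n * \<psi> x)"
        using \<psi>(1) by (intro continuous_intros)
      then have "((\<lambda>x. x ^ Suc n * \<psi> x) \<longlongrightarrow> x ^ Suc n * \<psi> x) (at x within {0<..1})"
        using False x by (simp add: continuous_on_def del: power_Suc)
      then have "((\<lambda>x. x ^ Suc n * \<psi> x) \<longlongrightarrow> x ^ Suc n * \<psi> x) (at x within {0..1})"
        using False x at_within_Ioc[of x] by simp
      then have "(?e \<longlongrightarrow> x ^ Suc n * \<psi> x) (at x within {0..1})"
        by (rule Lim_transform_within[where d = x]) (use False x in \<open>auto simp: dist_real_def\<close>)
      with False show ?thesis by simp
    qed
  qed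
  then have 3: "continuous_on {0..1} q"
    unfolding q_def using c by (intro continuous_intros)
  have 2: "(p has_real_derivative q x) (at x within {0..1})" if "x \<in> {0..1}" for x
  proof (rule has_real_derivative_continuous_extension[OF cp 3 _ that])
    fix y :: real assume y: "y \<in> {0<..<1}"
    then have "(\<phi> has_real_derivative \<psi> y) (at y)"
      using d[of y] by (simp add: at_within_Icc_at)
    then show "(p has_real_derivative q y) (at y)"
      unfolding p_def q_def using y
      by (auto intro!: derivative_eq_intros simp del: power_Suc)
  qed
  have 4: "p x \<ge> 0 \<and> x * q x - real (Suc n) * p x \<ge> 0" if x: "x \<in> {0..1}" for x
  proof -
    have "x * q x - real (Suc n) * p x = (if x = 0 then 0 else x ^ Suc (Suc n) * \<psi> x)"
      by (simp add: p_def q_def algebra_simps)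
    then show ?thesis
      using x nn[of x] \<psi>(2)[of x] by (simp add: p_def del: power_Suc)
  qed
  show thesis using that 1 2 3 4 by blast
qed

section \<open>The equivalence\<close>

theorem theorem3p3:
  fixes j :: nat and f :: "real \<Rightarrow> real"
  defines "f' \<equiv> deriv_within f {0..1}"
  defines "f'' \<equiv> deriv_within f' {0..1}"
  assumes "j \<ge> 2"
  shows "(f \<in> Ck 2 {0..1} \<inter> K1 j \<longleftrightarrow>
            f \<in> Ck 2 {0..1} \<and> (\<forall>x\<in>{0..1}. f' x \<ge> 0 \<and> x * f'' x - (real j - 1) * f' x \<ge> 0))
       \<and> (f \<in> Ck 2 {0..1} \<and> (\<forall>x\<in>{0..1}. f' x \<ge> 0 \<and> x * f'' x - (real j - 1) * f' x \<ge> 0) \<longleftrightarrow>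
            (\<exists>\<phi>\<in>Omega j. \<forall>x\<in>{0..1}. f x = f 0 + integral {0..x} (\<lambda>t. t ^ (j - 1) * \<phi> t)))"
proof -
  obtain n where j: "j = Suc (Suc n)"
    using \<open>j \<ge> 2\<close> by (metis Suc_le_D numeral_2_eq_2 Suc_le_mono)
  have derivs: "(f has_real_derivative f' x) (at x within {0..1})"
      "(f' has_real_derivative f'' x) (at x within {0..1})"
    if "f \<in> Ck 2 {0..1}" "x \<in> {0..1}" for x
    using that by (auto simp: numeral_2_eq_2 f'_def f''_def intro!: has_real_derivative_deriv_within)
  have cf'': "continuous_on {0..1} f''" if "f \<in> Ck 2 {0..1}"
    using that by (simp add: numeral_2_eq_2 f'_def f''_def)
  have cond: "(\<forall>x\<in>{0..1}. f' x \<ge> 0 \<and> x * f'' x - (real j - 1) * f' x \<ge> 0) \<longleftrightarrow>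
      (\<forall>x\<in>{0..1}. f' x \<ge> 0 \<and> x * f'' x - real (Suc n) * f' x \<ge> 0)" (is "?C \<longleftrightarrow> _")
    by (simp add: j)
  have ab: "f \<in> K1 j \<longleftrightarrow> ?C" if "f \<in> Ck 2 {0..1}"
    unfolding cond unfolding j by (rule K1_iff[OF derivs[OF that] cf''[OF that]])
  have bc: "\<exists>\<phi>\<in>Omega j. \<forall>x\<in>{0..1}. f x = f 0 + integral {0..x} (\<lambda>t. t ^ (j - 1) * \<phi> t)"
    if "f \<in> Ck 2 {0..1}" ?C
    using weight_exists[OF derivs[OF that(1)] cf''[OF that(1)], of n] that(2)
    unfolding cond unfolding j by (simp del: power_Suc of_nat_Suc)
  have cb: "f \<in> Ck 2 {0..1} \<and> ?C"
    if \<phi>: "\<phi> \<in> Omega j" "\<forall>x\<in>{0..1}. f x = f 0 + integral {0..x} (\<lambda>t. t ^ (j - 1) * \<phi> t)" for \<phi>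
  proof -
    have f_eq: "f x = f 0 + integral {0..x} (\<lambda>t. t ^ Suc n * \<phi> t)" if "x \<in> {0..1}" for x
      using bspec[OF \<phi>(2) that] by (simp only: j diff_Suc_1)
    obtain p q where f: "\<And>x. x \<in> {0..1} \<Longrightarrow> (f has_real_derivative p x) (at x within {0..1})"
      and p: "\<And>x. x \<in> {0..1} \<Longrightarrow> (p has_real_derivative q x) (at x within {0..1})"
      and q: "continuous_on {0..1} q"
      and nn: "\<And>x. x \<in> {0..1} \<Longrightarrow> p x \<ge> 0 \<and> x * q x - real (Suc n) * p x \<ge> 0"
      using derivs_of_weighted_integral[OF \<phi>(1)[unfolded j] f_eq] by blast
    have "p \<in> Ck (Suc 0) {0..1}"
      using p q Icc_not_singleton by (subst Ck_Suc_iff) auto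
    then have C2: "f \<in> Ck 2 {0..1}"
      unfolding numeral_2_eq_2 using f Icc_not_singleton by (subst Ck_Suc_iff) auto
    have f': "f' x = p x" if "x \<in> {0..1}" for x
      unfolding f'_def using f that Icc_not_singleton by (intro deriv_within_eqI) auto
    have "f'' x = q x" if "x \<in> {0..1}" for x
      unfolding f''_def using deriv_within_cong[OF f' that] p that Icc_not_singleton
      by (simp add: deriv_within_eqI)
    with C2 nn f' show ?thesis unfolding cond by simp
  qed
  from ab bc cb show ?thesis by blast
qed
end
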